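(* Let $\Gamma$ be a finite set of sentences and $\varphi$ a sentence of the logic of strict majorities. If every measurable model that satisfies all sentences of $\Gamma$ also satisfies $\varphi$, then $\Gamma\vdash\varphi$.
   Context: Syntax. Fix atomic predicates $X_1,X_2,\dots$. Terms: $t ::= X \mid \neg t\mid t\wedge t$. Sentences: $\varphi ::= \mathsf{A}\,t\mid \mathsf{M}\,t\mid\neg\varphi\mid\varphi\wedge\varphi$. Other Boolean connectives (on terms and on sentences) are abbreviations as usual; empty conjunctions are $\top$ and empty disjunctions are $\bot$. The term $\bot$ is $X\wedge\neg X$ and $\top$ is $\neg\bot$. Abbreviations: $\mathsf{H}\,t$ is $\neg\mathsf{M}\,t\wedge\neg\mathsf{M}\,\neg t$; $\mathsf{L}\,t$ is $\mathsf{M}\,t\vee\mathsf{H}\,t$; $\mathsf{E}\,t$ is $\neg\mathsf{A}\,\neg t$. Terms are taken modulo Boolean equivalence: if $t,t'$ are equivalent by the equational laws of Boolean algebra, then $\mathsf{A}\,t$ and $\mathsf{A}\,t'$ are identified, and $\mathsf{M}\,t$ and $\mathsf{M}\,t'$ are identified. Semantics. A finite social decision frame is a pair $(W,\mathcal{M})$ with $W$ a nonempty finite set and $\mathcal{M}$ a family of subsets of $W$. It is measurable if there is a finitely additive natural-number-valued $\mu$ on subsets of $W$ with $\mu(\varnothing)=0$, $\mu(\{w\})>0$ for all $w\in W$, and, for all $A\subseteq W$, $A\in\mathcal{M}$ iff $\mu(A)>\frac12\mu(W)$. A model is a frame with a set $[\![X]\!]\subseteq W$ for each atomic predicate $X$;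 it is measurable if its frame is. Put $[\![\neg t]\!]=W\setminus[\![t]\!]$ and $[\![t\wedge u]\!]=[\![t]\!]\cap[\![u]\!]$. The model satisfies $\mathsf{A}\,t$ iff $[\![t]\!]=W$, and satisfies $\mathsf{M}\,t$ iff $[\![t]\!]\in\mathcal{M}$; sentential connectives are classical. Proof system. The only rule is modus ponens. Axioms: (i) all sentences that are substitution instances of propositional tautologies; (ii) $\mathsf{E}\,\top\wedge\mathsf{A}\,\top$; (iii) $\mathsf{A}(t\to u)\to(\mathsf{A}\,t\to\mathsf{A}\,u)$ for all terms $t,u$; (iv) coherence: for every finite sequence of terms $u_1,\dots,u_k$, $$\Bigl(\bigwedge_{i\le k}\mathsf{L}\,u_i\wedge\mathsf{A}\Bigl(\bigvee_{S\subseteq[k],\,|S|\ge k/2}\ \bigwedge_{i\in S}\neg u_i\Bigr)\Bigr)\to\Bigl(\bigwedge_{i\le k}\mathsf{H}\,u_i\wedge\mathsf{A}\Bigl(\bigvee_{S\subseteq[k],\,|S|= k/2}\bigl(\bigwedge_{i\in S}u_i\wedge\bigwedge_{i\notin S}\neg u_i\bigr)\Bigr)\Bigr),$$ where $[k]=\{1,\dots,k\}$. $\Gamma\vdash\varphi$ means that $\varphi$ is derivable from $\Gamma$ and the axioms by modus ponens. *)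

theory Defs
  imports Main
begin

datatype rterm = RVar nat | RNeg rterm | RAnd rterm rterm

definition ROr :: "rterm \<Rightarrow> rterm \<Rightarrow> rterm" where
  "ROr t u = RNeg (RAnd (RNeg t) (RNeg u))"

definition RBot :: rterm where
  "RBot = RAnd (RVar 0) (RNeg (RVar 0))"

definition RTop :: rterm where
  "RTop = RNeg RBot"

text \<open>
  Derivability of an equation between terms from the laws of Boolean algebra by equational
  logic. The laws for join hold of the abbreviation \<open>ROr\<close>, so double negation and
  De Morgan are derivable.
\<close>

inductive beq :: "rterm \<Rightarrow> rterm \<Rightarrow> bool" where
  refl: "beq t t"
| sym: "beq t u \<Longrightarrow> beq u t"
| trans: "beq t u \<Longrightarrow> beq u v \<Longrightarrow> beq t v"
| cong_neg: "beq t t' \<Longrightarrow> beq (RNeg t) (RNeg t')"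
| cong_and: "beq t t' \<Longrightarrow> beq u u' \<Longrightarrow> beq (RAnd t u) (RAnd t' u')"
| and_comm: "beq (RAnd t u) (RAnd u t)"
| or_comm: "beq (ROr t u) (ROr u t)"
| and_assoc: "beq (RAnd (RAnd t u) v) (RAnd t (RAnd u v))"
| or_assoc: "beq (ROr (ROr t u) v) (ROr t (ROr u v))"
| and_absorb: "beq (RAnd t (ROr t u)) t"
| or_absorb: "beq (ROr t (RAnd t u)) t"
| and_distrib: "beq (RAnd t (ROr u v)) (ROr (RAnd t u) (RAnd t v))"
| or_distrib: "beq (ROr t (RAnd u v)) (RAnd (ROr t u) (ROr t v))"
| and_top: "beq (RAnd t RTop) t"
| or_bot: "beq (ROr t RBot) t"
| and_compl: "beq (RAnd t (RNeg t)) RBot"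
| or_compl: "beq (ROr t (RNeg t)) RTop"

lemma equivp_beq: "equivp beq"
  by (rule equivpI) (auto intro!: reflpI sympI transpI intro: beq.refl beq.sym beq.trans)

quotient_type bterm = rterm / beq
  by (rule equivp_beq)

lift_definition TVar :: "nat \<Rightarrow> bterm" is RVar .

lift_definition TNeg :: "bterm \<Rightarrow> bterm" is RNeg
  by (rule beq.cong_neg)

lift_definition TAnd :: "bterm \<Rightarrow> bterm \<Rightarrow> bterm" is RAnd
  by (rule beq.cong_and)

definition TOr :: "bterm \<Rightarrow> bterm \<Rightarrow> bterm" where
  "TOr t u = TNeg (TAnd (TNeg t) (TNeg u))"

definition TImp :: "bterm \<Rightarrow> bterm \<Rightarrow> bterm" where
  "TImp t u = TNeg (TAnd t (TNeg u))"

definition TBot :: bterm where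
  "TBot = TAnd (TVar 0) (TNeg (TVar 0))"

definition TTop :: bterm where
  "TTop = TNeg TBot"

definition TConj :: "bterm list \<Rightarrow> bterm" where
  "TConj ts = foldr TAnd ts TTop"

definition TDisj :: "bterm list \<Rightarrow> bterm" where
  "TDisj ts = foldr TOr ts TBot"

datatype sentence =
    Every bterm
  | Most bterm
  | Neg sentence
  | And sentence sentence

definition Or :: "sentence \<Rightarrow> sentence \<Rightarrow> sentence" where
  "Or p q = Neg (And (Neg p) (Neg q))"

definition Imp :: "sentence \<Rightarrow> sentence \<Rightarrow> sentence" where
  "Imp p q = Neg (And p (Neg q))"

definition Bot :: sentence where
  "Bot = And (Every (TVar 0)) (Neg (Every (TVar 0)))"

definition Top :: sentence where
  "Top = Neg Bot"

definition Conj :: "sentence list \<Rightarrow> sentence" where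
  "Conj ps = foldr And ps Top"

definition Half :: "bterm \<Rightarrow> sentence" where
  "Half t = And (Neg (Most t)) (Neg (Most (TNeg t)))"

definition AtLeastHalf :: "bterm \<Rightarrow> sentence" where
  "AtLeastHalf t = Or (Most t) (Half t)"

definition Exists :: "bterm \<Rightarrow> sentence" where
  "Exists t = Neg (Every (TNeg t))"

record 'w model =
  worlds :: "'w set"
  majorities :: "'w set set"
  interp :: "nat \<Rightarrow> 'w set"

definition frame :: "'w set \<Rightarrow> 'w set set \<Rightarrow> bool" where
  "frame W \<M> \<longleftrightarrow> finite W \<and> W \<noteq> {} \<and> \<M> \<subseteq> Pow W"

definition measurable_frame :: "'w set \<Rightarrow> 'w set set \<Rightarrow> bool" where
  "measurable_frame W \<M> \<longleftrightarrow> frame W \<M> \<and>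
     (\<exists>\<mu> :: 'w set \<Rightarrow> nat.
        \<mu> {} = 0 \<and>
        (\<forall>A B. A \<subseteq> W \<longrightarrow> B \<subseteq> W \<longrightarrow> A \<inter> B = {} \<longrightarrow> \<mu> (A \<union> B) = \<mu> A + \<mu> B) \<and>
        (\<forall>w\<in>W. \<mu> {w} > 0) \<and>
        (\<forall>A. A \<subseteq> W \<longrightarrow> (A \<in> \<M> \<longleftrightarrow> 2 * \<mu> A > \<mu> W)))"

definition is_model :: "'w model \<Rightarrow> bool" where
  "is_model \<MM> \<longleftrightarrow> frame (worlds \<MM>) (majorities \<MM>) \<and> (\<forall>x. interp \<MM> x \<subseteq> worlds \<MM>)"

definition measurable_model :: "'w model \<Rightarrow> bool" where
  "measurable_model \<MM> \<longleftrightarrow>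
     is_model \<MM> \<and> measurable_frame (worlds \<MM>) (majorities \<MM>)"

primrec rdenot :: "'w set \<Rightarrow> (nat \<Rightarrow> 'w set) \<Rightarrow> rterm \<Rightarrow> 'w set" where
  "rdenot W V (RVar x) = V x"
| "rdenot W V (RNeg t) = W - rdenot W V t"
| "rdenot W V (RAnd t u) = rdenot W V t \<inter> rdenot W V u"

text \<open>
  The denotation respects Boolean equivalence only if every atomic predicate denotes a subset
  of \<open>W\<close>. Intersecting with \<open>W\<close> makes it total on the quotient and changes nothing in a model.
\<close>

lemma rdenot_subset: "(\<And>x. V x \<subseteq> W) \<Longrightarrow> rdenot W V t \<subseteq> W"
  by (induction t) auto

lemma rdenot_beq:
  assumes "\<And>x. V x \<subseteq> W" and "beq t u"
  shows "rdenot W V t = rdenot W V u"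
  using assms(2)
  by induction (use rdenot_subset[of V W, OF assms(1)] in
    \<open>fastforce simp: ROr_def RTop_def RBot_def\<close>)+

lift_definition denot :: "'w set \<Rightarrow> (nat \<Rightarrow> 'w set) \<Rightarrow> bterm \<Rightarrow> 'w set" is
  "\<lambda>W V. rdenot W (\<lambda>x. V x \<inter> W)"
  by (rule rdenot_beq) auto

lemma denot_simps:
  "V x \<subseteq> W \<Longrightarrow> denot W V (TVar x) = V x"
  "denot W V (TNeg t) = W - denot W V t"
  "denot W V (TAnd t u) = denot W V t \<inter> denot W V u"
  by (transfer; auto)+

primrec sat :: "'w model \<Rightarrow> sentence \<Rightarrow> bool" (infix "\<Turnstile>" 50) where
  "(\<MM> \<Turnstile> Every t) \<longleftrightarrow> denot (worlds \<MM>) (interp \<MM>) t = worlds \<MM>"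
| "(\<MM> \<Turnstile> Most t) \<longleftrightarrow> denot (worlds \<MM>) (interp \<MM>) t \<in> majorities \<MM>"
| "(\<MM> \<Turnstile> Neg p) \<longleftrightarrow> \<not> (\<MM> \<Turnstile> p)"
| "(\<MM> \<Turnstile> And p q) \<longleftrightarrow> (\<MM> \<Turnstile> p) \<and> (\<MM> \<Turnstile> q)"

datatype pform = PVar nat | PNeg pform | PAnd pform pform

primrec peval :: "(nat \<Rightarrow> bool) \<Rightarrow> pform \<Rightarrow> bool" where
  "peval v (PVar n) = v n"
| "peval v (PNeg a) = (\<not> peval v a)"
| "peval v (PAnd a b) = (peval v a \<and> peval v b)"

definition tautology :: "pform \<Rightarrow> bool" where
  "tautology a \<longleftrightarrow> (\<forall>v. peval v a)"

primrec psubst :: "(nat \<Rightarrow> sentence) \<Rightarrow> pform \<Rightarrow> sentence" where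
  "psubst \<sigma> (PVar n) = \<sigma> n"
| "psubst \<sigma> (PNeg a) = Neg (psubst \<sigma> a)"
| "psubst \<sigma> (PAnd a b) = And (psubst \<sigma> a) (psubst \<sigma> b)"

text \<open>
  A sequence of terms is a list \<open>us\<close>, indexed by \<open>{0..<k}\<close> with \<open>k = length us\<close>.
  \<open>subseqs [0..<k]\<close> lists every subset of the index set exactly once, each as an increasing list.
\<close>

definition coherence :: "bterm list \<Rightarrow> sentence" where
  "coherence us =
    (let k = length us; subsets = subseqs [0..<k] in
     Imp
       (And (Conj (map AtLeastHalf us))
          (Every (TDisj [TConj [TNeg (us ! i). i \<leftarrow> S]. S \<leftarrow> subsets, 2 * length S \<ge> k])))
       (And (Conj (map Half us))
          (Every (TDisj [TAnd (TConj [us ! i. i \<leftarrow> S])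
                            (TConj [TNeg (us ! i). i \<leftarrow> [0..<k], i \<notin> set S]).
                       S \<leftarrow> subsets, 2 * length S = k]))))"

inductive derivable :: "sentence set \<Rightarrow> sentence \<Rightarrow> bool" (infix "\<turnstile>" 50)
  for \<Gamma> :: "sentence set" where
  premise: "p \<in> \<Gamma> \<Longrightarrow> \<Gamma> \<turnstile> p"
| taut: "tautology a \<Longrightarrow> \<Gamma> \<turnstile> psubst \<sigma> a"
| nonempty: "\<Gamma> \<turnstile> And (Exists TTop) (Every TTop)"
| all_imp: "\<Gamma> \<turnstile> Imp (Every (TImp t u)) (Imp (Every t) (Every u))"
| coherence: "\<Gamma> \<turnstile> coherence us"
| mp: "\<Gamma> \<turnstile> p \<Longrightarrow> \<Gamma> \<turnstile> Imp p q \<Longrightarrow> \<Gamma> \<turnstile> q"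

end

theory Submission
  imports Defs
begin

text \<open>
  If \<open>\<Gamma>\<close> does not derive \<open>\<phi>\<close>, extend it to a maximal theory \<open>\<Delta>\<close> not deriving \<open>\<phi>\<close>. The worlds are
  the state descriptions over the first \<open>n\<close> atomic predicates whose existence \<open>\<Delta>\<close> asserts, where
  \<open>n\<close> covers all terms of \<open>\<Gamma>\<close> and \<open>\<phi>\<close>; the majorities are the denotations of the terms that
  \<open>\<Delta>\<close> calls majorities. A measure is a positive integer solution of a finite
  system of strict and weak linear inequalities. If it had no solution, Farkas' lemma would
  provide nonnegative integer multipliers, and listing each set as often as its multiplier says
  would violate a coherence axiom.
\<close>

section \<open>Integer Farkas lemma\<close>

text \<open>One identity covers additivity, homogeneity and, at \<open>a = b = 0\<close>, vanishing
  at 0.\<close>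

definition lin :: "(('a \<Rightarrow> int) \<Rightarrow> int) \<Rightarrow> bool" where
  "lin f \<longleftrightarrow> (\<forall>a b x y. f (\<lambda>w. a * x w + b * y w) = a * f x + b * f y)"

lemma linD: "lin f \<Longrightarrow> f (\<lambda>w. a * x w + b * y w) = a * f x + b * f y"
  by (simp add: lin_def)

lemma lin_minus: "lin f \<Longrightarrow> lin (\<lambda>x. - f x)"
  by (simp add: lin_def)

lemma lin_combine: "lin f \<Longrightarrow> lin g \<Longrightarrow> lin (\<lambda>x. a * f x + b * g x)"
  by (simp add: lin_def algebra_simps)

lemma lin_point: "lin (\<lambda>x. x w)"
  by (simp add: lin_def)

lemma lin_sum_point: "lin (\<lambda>x. \<Sum>w\<in>A. x w)"
  by (simp add: lin_def sum.distrib sum_distrib_left)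

lemma lin_sum:
  assumes "lin f" "finite S"
  shows "f (\<lambda>w. \<Sum>s\<in>S. x s w) = (\<Sum>s\<in>S. f (x s))"
  using assms(2)
proof (induction S rule: finite_induct)
  case empty
  show ?case using linD[OF assms(1), of 0 undefined 0 undefined] by simp
next
  case (insert s S)
  then show ?case
    using linD[OF assms(1), of 1 "x s" 1 "\<lambda>w. \<Sum>s\<in>S. x s w"] by simp
qed

text \<open>Induction on the constraints, eliminating one at a time. Integers admit no division, so
  \<open>g\<close> carries a positive factor \<open>d\<close> where rational multipliers would be
  usual.\<close>

lemma farkas:
  fixes f :: "'i \<Rightarrow> ('a \<Rightarrow> int) \<Rightarrow> int"
  assumes "finite I" "\<And>i. i \<in> I \<Longrightarrow> lin (f i)" "lin g"
    and "\<And>x. (\<And>i. i \<in> I \<Longrightarrow> 0 \<le> f i x) \<Longrightarrow> 0 \<le> g x"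
  shows "\<exists>c d. 0 < d \<and> (\<forall>i\<in>I. 0 \<le> c i) \<and> (\<forall>x. d * g x = (\<Sum>i\<in>I. c i * f i x))"
  using assms
proof (induction I arbitrary: f g rule: finite_induct)
  case empty
  \<comment> \<open>Without constraints, \<open>g\<close> is nonnegative at both \<open>x\<close>
    and \<open>-x\<close>.\<close>
  have "g x = 0" for x
    using empty.prems(3)[of x] empty.prems(3)[of "\<lambda>w. - x w"]
      linD[OF empty.prems(2), of "-1" x 0 x] by simp
  then show ?case by (intro exI[of _ 1] exI) auto
next
  case (insert m I)
  show ?case
  proof (cases "\<forall>x. (\<forall>i\<in>I. 0 \<le> f i x) \<longrightarrow> 0 \<le> g x")
    case True
    then obtain c d where cd: "0 < d" "\<forall>i\<in>I. 0 \<le> c i" "\<forall>x. d * g x = (\<Sum>i\<in>I. c i * f i x)"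
      using insert.IH[of f g] insert.prems by auto
    have "(\<Sum>i\<in>I. (c(m := 0)) i * f i x) = (\<Sum>i\<in>I. c i * f i x)" for x
      using insert.hyps by (intro sum.cong) auto
    then show ?thesis
      using cd insert.hyps by (intro exI[of _ "c(m := 0)"] exI[of _ d]) auto
  next
    case False
    then obtain z where z: "\<And>i. i \<in> I \<Longrightarrow> 0 \<le> f i z" "g z < 0" by force
    \<comment> \<open>Were \<open>f m z\<close> nonnegative, \<open>z\<close> would satisfy every
      constraint and still make \<open>g\<close> negative; hence \<open>a\<close> is
      positive.\<close>
    define a where "a = - f m z"
    have a: "0 < a"
      using insert.prems(3)[of z] z by (force simp: a_def)
    have lin: "lin g" "lin (f m)" "\<And>i. i \<in> I \<Longrightarrow> lin (f i)"
      using insert.prems by auto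
    \<comment> \<open>The point \<open>a x + f\<^sub>m(x) z\<close> lies on the hyperplane \<open>f\<^sub>m = 0\<close>; pull all functionals back to it.\<close>
    have "\<exists>c d. 0 < d \<and> (\<forall>i\<in>I. 0 \<le> c i) \<and>
        (\<forall>x. d * (a * g x + g z * f m x) = (\<Sum>i\<in>I. c i * (a * f i x + f i z * f m x)))"
    proof (rule insert.IH)
      show "lin (\<lambda>x. a * f i x + f i z * f m x)" if "i \<in> I" for i
        using that lin by (intro lin_combine)
      show "lin (\<lambda>x. a * g x + g z * f m x)"
        using lin by (intro lin_combine)
      fix x assume *: "\<And>i. i \<in> I \<Longrightarrow> 0 \<le> a * f i x + f i z * f m x"
      let ?y = "\<lambda>w. a * x w + f m x * z w"
      have "0 \<le> f i ?y" if "i \<in> insert m I" for i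
      proof (cases "i = m")
        case True
        then show ?thesis using linD[OF lin(2), of a x "f m x" z] by (simp add: a_def)
      next
        case False
        then show ?thesis
          using that *[of i] linD[OF lin(3), of i a x "f m x" z] by (simp add: mult.commute)
      qed
      then have "0 \<le> g ?y" by (rule insert.prems(3))
      then show "0 \<le> a * g x + g z * f m x"
        using linD[OF lin(1), of a x "f m x" z] by (simp add: mult.commute)
    qed
    then obtain c d where cd: "0 < d" "\<forall>i\<in>I. 0 \<le> c i"
      "\<And>x. d * (a * g x + g z * f m x) = (\<Sum>i\<in>I. c i * (a * f i x + f i z * f m x))"
      by blast
    \<comment> \<open>Expanding the identity for the pulled-back functionals and collecting the
      terms in \<open>f m x\<close> leaves exactly \<open>e\<close> as the multiplier of the
      eliminated constraint.\<close>
    define e where "e = (\<Sum>i\<in>I. c i * f i z) - d * g z"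
    have "0 \<le> e"
    proof -
      have "0 \<le> (\<Sum>i\<in>I. c i * f i z)" using cd(2) z(1) by (intro sum_nonneg) auto
      moreover have "d * g z \<le> 0" using cd(1) z(2) by (simp add: mult_le_0_iff)
      ultimately show ?thesis by (simp add: e_def)
    qed
    moreover have "(d * a) * g x = (\<Sum>i\<in>insert m I. ((\<lambda>i. c i * a)(m := e)) i * f i x)" for x
    proof -
      have "(\<Sum>i\<in>I. ((\<lambda>i. c i * a)(m := e)) i * f i x) = (\<Sum>i\<in>I. c i * a * f i x)"
        using insert.hyps by (intro sum.cong) auto
      moreover have "(\<Sum>i\<in>I. c i * (a * f i x + f i z * f m x)) =
          (\<Sum>i\<in>I. c i * a * f i x) + (\<Sum>i\<in>I. c i * f i z) * f m x"
        by (simp add: sum.distrib sum_distrib_left algebra_simps)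
      ultimately show ?thesis
        using cd(3)[of x] insert.hyps by (simp add: e_def algebra_simps)
    qed
    ultimately show ?thesis
      using cd a by (intro exI[of _ "(\<lambda>i. c i * a)(m := e)"] exI[of _ "d * a"]) auto
  qed
qed

text \<open>If no solution is strict at \<open>s\<close>, Farkas applied to \<open>- f s\<close>
  gives a vanishing nonnegative combination with positive weight on \<open>s\<close>, which
  \<open>alt\<close> forbids. Summing the solutions found for the single \<open>s\<close> makes all
  of \<open>S\<close> strict at once.\<close>

lemma positive_solution:
  fixes f :: "'i \<Rightarrow> ('a \<Rightarrow> int) \<Rightarrow> int"
  assumes "finite I" "S \<subseteq> I" "\<And>i. i \<in> I \<Longrightarrow> lin (f i)"
    and alt: "\<And>c :: 'i \<Rightarrow> nat. (\<And>x. (\<Sum>i\<in>I. int (c i) * f i x) = 0) \<Longrightarrow> \<forall>s\<in>S. c s = 0"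
  shows "\<exists>x. (\<forall>i\<in>I. 0 \<le> f i x) \<and> (\<forall>s\<in>S. 0 < f s x)"
proof -
  have "\<exists>x. (\<forall>i\<in>I. 0 \<le> f i x) \<and> 0 < f s x" if s: "s \<in> S" for s
  proof (rule ccontr)
    assume no: "\<not> ?thesis"
    have sI: "s \<in> I" using s assms(2) by blast
    have "\<exists>c d. 0 < d \<and> (\<forall>i\<in>I. 0 \<le> c i) \<and> (\<forall>x. d * - f s x = (\<Sum>i\<in>I. c i * f i x))"
    proof (rule farkas)
      show "0 \<le> - f s x" if "\<And>i. i \<in> I \<Longrightarrow> 0 \<le> f i x" for x
        using that no by force
      show "lin (\<lambda>x. - f s x)" using assms(3)[OF sI] by (rule lin_minus)
    qed (use assms in auto)
    then obtain c d where cd: "0 < d" "\<forall>i\<in>I. 0 \<le> c i" "\<And>x. d * - f s x = (\<Sum>i\<in>I. c i * f i x)"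
      by blast
    \<comment> \<open>Moving \<open>d * f s x\<close> across the equation adds \<open>d\<close> to
      the multiplier of \<open>s\<close>. On \<open>I\<close> all values are nonnegative, so
      \<open>nat\<close> loses nothing.\<close>
    let ?c = "\<lambda>i. nat (c i + (if i = s then d else 0))"
    have "(\<Sum>i\<in>I. int (?c i) * f i x) = 0" for x
    proof -
      have "(\<Sum>i\<in>I. int (?c i) * f i x) = (\<Sum>i\<in>I. c i * f i x + (if i = s then d * f i x else 0))"
        using cd by (intro sum.cong) (auto simp: algebra_simps)
      also have "\<dots> = 0"
        using cd(3)[of x] sI assms(1) by (simp add: sum.distrib)
      finally show ?thesis .
    qed
    then have "?c s = 0" using alt[of ?c] s by blast
    then show False using cd sI by force
  qed
  then obtain x where x: "\<And>s i. s \<in> S \<Longrightarrow> i \<in> I \<Longrightarrow> 0 \<le> f i (x s)" "\<And>s. s \<in> S \<Longrightarrow> 0 < f s (x s)"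
    by metis
  have fin: "finite S" using assms finite_subset by blast
  let ?x = "\<lambda>w. \<Sum>s\<in>S. x s w"
  have eq: "f i ?x = (\<Sum>s\<in>S. f i (x s))" if "i \<in> I" for i
    using lin_sum[OF assms(3)[OF that] fin] by simp
  show ?thesis
  proof (intro exI[of _ ?x] conjI ballI)
    show "0 \<le> f i ?x" if "i \<in> I" for i
      using x that by (simp add: eq sum_nonneg)
    show "0 < f s ?x" if "s \<in> S" for s
    proof -
      have "s \<in> I" using that assms by blast
      then have "0 < (\<Sum>t\<in>S. f s (x t))"
        using x that fin by (intro sum_pos2[of S s]) auto
      then show ?thesis using eq[OF \<open>s \<in> I\<close>] by simp
    qed
  qed
qed

section \<open>Coherent frames are measurable\<close>

text \<open>Turns multipliers into a list, since coherence speaks of sequences with repetitions.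
  Letting \<open>P\<close> range over all predicates yields the total length and the counts per
  world from one list.\<close>

lemma list_with_multiplicities:
  assumes "finite I"
  shows "\<exists>xs. set xs = {i \<in> I. c i > 0} \<and>
    (\<forall>P. length (filter P xs) = (\<Sum>i\<in>I. if P i then c i else 0))"
  using assms
proof (induction I rule: finite_induct)
  case empty
  then show ?case by simp
next
  case (insert j I)
  then obtain xs where "set xs = {i \<in> I. c i > 0}"
    "\<forall>P. length (filter P xs) = (\<Sum>i\<in>I. if P i then c i else 0)" by blast
  then show ?case
    using insert.hyps by (intro exI[of _ "replicate (c j) j @ xs"]) (auto simp: filter_replicate)
qed

text \<open>The coherence axiom read in the frame, with sets in place of terms. The disjunction
  \<open>A \<in> \<M> \<or> W - A \<notin> \<M>\<close> is the meaning of
  \<open>AtLeastHalf\<close>; lying in at most half of the sets is lying outside at least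
  half.\<close>

definition coherent_frame :: "'w set \<Rightarrow> 'w set set \<Rightarrow> bool" where
  "coherent_frame W \<M> \<longleftrightarrow>
    (\<forall>As. (\<forall>A\<in>set As. A \<subseteq> W \<and> (A \<in> \<M> \<or> W - A \<notin> \<M>)) \<longrightarrow>
      (\<forall>w\<in>W. 2 * length (filter (\<lambda>A. w \<in> A) As) \<le> length As) \<longrightarrow>
      (\<forall>A\<in>set As. A \<notin> \<M>) \<and> (\<forall>w\<in>W. 2 * length (filter (\<lambda>A. w \<in> A) As) = length As))"

text \<open>The unknowns are the weights of the worlds. By \<open>positive_solution\<close> it
  suffices that a vanishing nonnegative combination puts no weight on a strict inequality; the sets
  in it, repeated by multiplicity, form a list to which coherence applies.\<close>

lemma coherent_frame_measurable:
  fixes W :: "'a set"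
  assumes fr: "frame W \<M>" and coh: "coherent_frame W \<M>"
  shows "measurable_frame W \<M>"
proof -
  have fin: "finite W" and sub: "\<M> \<subseteq> Pow W" using fr by (auto simp: frame_def)
  define \<L> where "\<L> = {A. A \<subseteq> W \<and> (A \<in> \<M> \<or> W - A \<notin> \<M>)}"
  have finL: "finite \<L>" unfolding \<L>_def using fin by simp
  have MsubL: "\<M> \<subseteq> \<L>" using sub by (auto simp: \<L>_def)
  \<comment> \<open>\<open>Inl A\<close> says that \<open>A\<close> weighs at least half, strictly
    so for majorities; \<open>Inr w\<close> says that \<open>w\<close> has positive weight.\<close>
  define f :: "'a set + 'a \<Rightarrow> ('a \<Rightarrow> int) \<Rightarrow> int"
    where "f i = (case i of Inl A \<Rightarrow> \<lambda>x. 2 * (\<Sum>w\<in>A. x w) + (-1) * (\<Sum>w\<in>W. x w) | Inr w \<Rightarrow> \<lambda>x. x w)" for i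
  have "\<exists>x. (\<forall>i\<in>\<L> <+> W. 0 \<le> f i x) \<and> (\<forall>s\<in>\<M> <+> W. 0 < f s x)"
  proof (rule positive_solution)
    show "finite (\<L> <+> W)" using fin finL by simp
    show "\<M> <+> W \<subseteq> \<L> <+> W" using MsubL by auto
    show "lin (f i)" for i
      by (cases i; simp only: f_def sum.case; intro lin_point lin_sum_point lin_combine)
    fix c :: "'a set + 'a \<Rightarrow> nat"
    assume zero: "\<And>x. (\<Sum>i\<in>\<L> <+> W. int (c i) * f i x) = 0"
    obtain As where As: "set As = {A \<in> \<L>. c (Inl A) > 0}"
      and len: "\<And>P. length (filter P As) = (\<Sum>A\<in>\<L>. if P A then c (Inl A) else 0)"
      using list_with_multiplicities[OF finL, of "\<lambda>A. c (Inl A)"] by blast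
    \<comment> \<open>Evaluation at the indicator of \<open>w\<close>: each set contributes its
      multiplier, with positive sign iff it contains \<open>w\<close>, and the world inequalities
      contribute \<open>c (Inr w)\<close>.\<close>
    have count: "2 * length (filter (\<lambda>A. w \<in> A) As) + c (Inr w) = length As" if w: "w \<in> W" for w
    proof -
      let ?x = "\<lambda>v. if v = w then 1 else 0 :: int"
      have inl: "f (Inl A) ?x = (if w \<in> A then 1 else -1)" if "A \<in> \<L>" for A
      proof -
        have "finite A" using that fin finite_subset by (auto simp: \<L>_def)
        then show ?thesis using w fin by (simp add: f_def)
      qed
      have "0 = (\<Sum>A\<in>\<L>. int (c (Inl A)) * f (Inl A) ?x) + (\<Sum>v\<in>W. int (c (Inr v)) * f (Inr v) ?x)"
        using zero[of ?x] fin finL by (simp add: sum.Plus)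
      also have "(\<Sum>A\<in>\<L>. int (c (Inl A)) * f (Inl A) ?x) =
          (\<Sum>A\<in>\<L>. 2 * int (if w \<in> A then c (Inl A) else 0) - int (c (Inl A)))"
        by (intro sum.cong) (auto simp: inl)
      also have "\<dots> = 2 * int (length (filter (\<lambda>A. w \<in> A) As)) - int (length As)"
        using len[of "\<lambda>A. w \<in> A"] len[of "\<lambda>_. True"] by (simp add: sum_subtractf sum_distrib_left)
      also have "(\<Sum>v\<in>W. int (c (Inr v)) * f (Inr v) ?x) = (\<Sum>v\<in>W. if v = w then int (c (Inr v)) else 0)"
        by (intro sum.cong) (auto simp: f_def)
      also have "\<dots> = int (c (Inr w))" using w fin by simp
      finally show ?thesis by linarith
    qed
    have "\<forall>A\<in>set As. A \<subseteq> W \<and> (A \<in> \<M> \<or> W - A \<notin> \<M>)" using As by (auto simp: \<L>_def)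
    moreover have "\<forall>w\<in>W. 2 * length (filter (\<lambda>A. w \<in> A) As) \<le> length As" using count by force
    ultimately have concl: "\<forall>A\<in>set As. A \<notin> \<M>"
      "\<forall>w\<in>W. 2 * length (filter (\<lambda>A. w \<in> A) As) = length As"
      using coh unfolding coherent_frame_def by blast+
    \<comment> \<open>A majority with positive multiplier would occur in \<open>As\<close>; equality
      in \<open>count\<close> leaves nothing for \<open>c (Inr w)\<close>.\<close>
    have "c (Inl A) = 0" if "A \<in> \<M>" for A using concl(1) As that MsubL by auto
    moreover have "c (Inr w) = 0" if "w \<in> W" for w using concl(2) count that by fastforce
    ultimately show "\<forall>s\<in>\<M> <+> W. c s = 0" by auto
  qed
  then obtain p where p: "\<And>i. i \<in> \<L> <+> W \<Longrightarrow> 0 \<le> f i p" "\<And>s. s \<in> \<M> <+> W \<Longrightarrow> 0 < f s p"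
    by blast
  have pos: "0 < p w" if "w \<in> W" for w using p(2)[of "Inr w"] that by (auto simp: f_def)
  define \<mu> where "\<mu> A = (\<Sum>w\<in>A. nat (p w))" for A
  have int_mu: "int (\<mu> A) = (\<Sum>w\<in>A. p w)" if "A \<subseteq> W" for A
  proof -
    have "int (\<mu> A) = (\<Sum>w\<in>A. int (nat (p w)))" by (simp add: \<mu>_def)
    also have "\<dots> = (\<Sum>w\<in>A. p w)" using that pos by (intro sum.cong) (auto intro: less_imp_le)
    finally show ?thesis .
  qed
  have f_Inl: "f (Inl A) p = 2 * int (\<mu> A) - int (\<mu> W)" if "A \<subseteq> W" for A
    by (simp add: f_def int_mu[OF that] int_mu[OF subset_refl])
  have add: "\<mu> (A \<union> B) = \<mu> A + \<mu> B" if "A \<subseteq> W" "B \<subseteq> W" "A \<inter> B = {}" for A B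
    unfolding \<mu>_def using that fin by (meson finite_subset sum.union_disjoint)
  have "A \<in> \<M> \<longleftrightarrow> \<mu> W < 2 * \<mu> A" if A: "A \<subseteq> W" for A
  proof
    assume "A \<in> \<M>"
    then show "\<mu> W < 2 * \<mu> A" using p(2)[OF InlI] f_Inl[OF A] by force
  next
    assume less: "\<mu> W < 2 * \<mu> A"
    show "A \<in> \<M>"
    proof (rule ccontr)
      assume "A \<notin> \<M>"
      \<comment> \<open>The complement of \<open>W - A\<close> is \<open>A\<close>, not a majority,
        so \<open>W - A\<close> weighs at least half.\<close>
      then have "W - A \<in> \<L>" using A by (auto simp: \<L>_def double_diff)
      then have "\<mu> W \<le> 2 * \<mu> (W - A)" using p(1)[OF InlI] f_Inl[of "W - A"] by force
      moreover have "\<mu> W = \<mu> A + \<mu> (W - A)"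
        using add[of A "W - A"] A by (simp add: Un_absorb1)
      ultimately show False using less by simp
    qed
  qed
  then show ?thesis
    unfolding measurable_frame_def using fr add pos
    by (intro conjI exI[of _ \<mu>]) (auto simp: \<mu>_def)
qed

section \<open>The Lindenbaum algebra of terms\<close>

text \<open>The quotient satisfies the Boolean laws by construction; the instance makes order and
  lattice facts available for terms, with \<open>\<le>\<close> as entailment.\<close>

instantiation bterm :: boolean_algebra
begin

definition inf_bterm :: "bterm \<Rightarrow> bterm \<Rightarrow> bterm" where "inf_bterm = TAnd"
definition sup_bterm :: "bterm \<Rightarrow> bterm \<Rightarrow> bterm" where "sup_bterm = TOr"
definition uminus_bterm :: "bterm \<Rightarrow> bterm" where "uminus_bterm = TNeg"
definition minus_bterm :: "bterm \<Rightarrow> bterm \<Rightarrow> bterm" where "minus_bterm t u = TAnd t (TNeg u)"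
definition bot_bterm :: bterm where "bot_bterm = TBot"
definition top_bterm :: bterm where "top_bterm = TTop"
definition less_eq_bterm :: "bterm \<Rightarrow> bterm \<Rightarrow> bool" where "less_eq_bterm t u \<longleftrightarrow> TAnd t u = t"
definition less_bterm :: "bterm \<Rightarrow> bterm \<Rightarrow> bool" where "less_bterm t u \<longleftrightarrow> t \<le> u \<and> \<not> u \<le> (t :: bterm)"

instance
proof
  have and_comm: "TAnd t u = TAnd u t" for t u
    by transfer (rule beq.and_comm)
  have or_comm: "TOr t u = TOr u t" for t u
    unfolding TOr_def by transfer (rule beq.or_comm[unfolded ROr_def])
  have and_assoc: "TAnd (TAnd t u) v = TAnd t (TAnd u v)" for t u v
    by transfer (rule beq.and_assoc)
  have and_absorb: "TAnd t (TOr t u) = t" for t u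
    unfolding TOr_def by transfer (rule beq.and_absorb[unfolded ROr_def])
  have or_absorb: "TOr t (TAnd t u) = t" for t u
    unfolding TOr_def by transfer (rule beq.or_absorb[unfolded ROr_def])
  have and_distrib: "TAnd t (TOr u v) = TOr (TAnd t u) (TAnd t v)" for t u v
    unfolding TOr_def by transfer (rule beq.and_distrib[unfolded ROr_def])
  have or_distrib: "TOr t (TAnd u v) = TAnd (TOr t u) (TOr t v)" for t u v
    unfolding TOr_def by transfer (rule beq.or_distrib[unfolded ROr_def])
  have and_top: "TAnd t TTop = t" for t
    unfolding TTop_def TBot_def by transfer (rule beq.and_top[unfolded RTop_def RBot_def])
  have or_bot: "TOr t TBot = t" for t
    unfolding TBot_def TOr_def by transfer (rule beq.or_bot[unfolded ROr_def RBot_def])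
  have and_compl: "TAnd t (TNeg t) = TBot" for t
    unfolding TBot_def by transfer (rule beq.and_compl[unfolded RBot_def])
  have or_compl: "TOr t (TNeg t) = TTop" for t
    unfolding TTop_def TBot_def TOr_def
    by transfer (rule beq.or_compl[unfolded ROr_def RTop_def RBot_def])
  \<comment> \<open>Reflexivity of the order is idempotence, which follows from the two absorption
    laws.\<close>
  have and_idem: "TAnd t t = t" for t
    by (metis and_absorb or_absorb)
  fix t u v :: bterm
  show "t < u \<longleftrightarrow> t \<le> u \<and> \<not> u \<le> t" by (simp add: less_bterm_def)
  show "t \<le> t" by (simp add: less_eq_bterm_def and_idem)
  show "t \<le> u \<Longrightarrow> u \<le> v \<Longrightarrow> t \<le> v" unfolding less_eq_bterm_def by (metis and_assoc)
  show "t \<le> u \<Longrightarrow> u \<le> t \<Longrightarrow> t = u" unfolding less_eq_bterm_def by (metis and_comm)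
  show "inf t u \<le> t" "inf t u \<le> u"
    unfolding less_eq_bterm_def inf_bterm_def by (metis and_assoc and_comm and_idem)+
  show "t \<le> u \<Longrightarrow> t \<le> v \<Longrightarrow> t \<le> inf u v"
    unfolding less_eq_bterm_def inf_bterm_def by (metis and_assoc)
  show "t \<le> sup t u" "u \<le> sup t u"
    unfolding less_eq_bterm_def sup_bterm_def by (metis and_absorb or_comm)+
  show "u \<le> t \<Longrightarrow> v \<le> t \<Longrightarrow> sup u v \<le> t"
    unfolding less_eq_bterm_def sup_bterm_def by (metis and_distrib and_comm)
  show "bot \<le> t"
    unfolding less_eq_bterm_def bot_bterm_def by (metis and_absorb or_bot or_comm)
  show "t \<le> top"
    unfolding less_eq_bterm_def top_bterm_def by (rule and_top)
  show "sup t (inf u v) = inf (sup t u) (sup t v)"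
    unfolding sup_bterm_def inf_bterm_def by (rule or_distrib)
  show "inf t (- t) = bot"
    unfolding inf_bterm_def uminus_bterm_def bot_bterm_def by (rule and_compl)
  show "sup t (- t) = top"
    unfolding sup_bterm_def uminus_bterm_def top_bterm_def by (rule or_compl)
  show "t - u = inf t (- u)"
    by (simp add: minus_bterm_def inf_bterm_def uminus_bterm_def)
qed

end

lemma lattice_ops:
  "TAnd t u = inf t u" "TOr t u = sup t u" "TNeg t = - t" "TBot = bot" "TTop = top"
  by (simp_all add: inf_bterm_def sup_bterm_def uminus_bterm_def bot_bterm_def top_bterm_def)

lemma TImp_eq: "TImp t u = sup (- t) u"
  by (simp add: TImp_def lattice_ops)

lemma bterm_induct [case_names TVar TNeg TAnd]:
  assumes "\<And>x. P (TVar x)" "\<And>t. P t \<Longrightarrow> P (TNeg t)" "\<And>t u. P t \<Longrightarrow> P u \<Longrightarrow> P (TAnd t u)"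
  shows "P t"
proof (rule bterm.abs_induct)
  show "P (abs_bterm r)" for r
    by (induction r) (use assms in \<open>simp_all flip: TVar.abs_eq TNeg.abs_eq TAnd.abs_eq\<close>)
qed

section \<open>Denotations of the Boolean operations\<close>

lemma denot_subset: "denot W V t \<subseteq> W"
  by transfer (auto intro!: rdenot_subset)

lemma denot_inf: "denot W V (inf t u) = denot W V t \<inter> denot W V u"
  by (simp add: denot_simps flip: lattice_ops)

lemma denot_uminus: "denot W V (- t) = W - denot W V t"
  by (simp add: denot_simps flip: lattice_ops)

lemma denot_sup: "denot W V (sup t u) = denot W V t \<union> denot W V u"
  using denot_inf[of W V "- t" "- u"] denot_uminus[of W V "sup t u"]
    denot_subset[of W V t] denot_subset[of W V u] denot_subset[of W V "sup t u"]
  by (auto simp: denot_uminus)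

lemma denot_bot: "denot W V bot = {}"
  using denot_inf[of W V "TVar 0" "- TVar 0"] by (auto simp: denot_uminus)

lemma denot_top: "denot W V top = W"
  using denot_uminus[of W V bot] by (simp add: denot_bot)

lemma denot_mono: "t \<le> u \<Longrightarrow> denot W V t \<subseteq> denot W V u"
  by (metis denot_inf inf.absorb_iff1 inf_le2)

lemma denot_TConj: "denot W V (TConj ts) = {w \<in> W. \<forall>t\<in>set ts. w \<in> denot W V t}"
  using denot_subset by (induction ts) (auto simp: TConj_def lattice_ops denot_inf denot_top)

lemma denot_TDisj: "denot W V (TDisj ts) = (\<Union>t\<in>set ts. denot W V t)"
  by (induction ts) (auto simp: TDisj_def lattice_ops denot_sup denot_bot)

section \<open>State descriptions\<close>

text \<open>The natural number \<open>w\<close> stands for the valuation making \<open>TVar i\<close> true iff bit \<open>i\<close> of \<open>w\<close> is set.\<close>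

primrec state_desc :: "nat \<Rightarrow> nat \<Rightarrow> bterm" where
  "state_desc 0 w = top"
| "state_desc (Suc n) w = inf (state_desc n w) (if bit w n then TVar n else - TVar n)"

lemma state_desc_cong:
  "(\<And>i. i < n \<Longrightarrow> bit v i = bit w i) \<Longrightarrow> state_desc n v = state_desc n w"
  by (induction n) auto

lemma state_desc_antimono: "m \<le> n \<Longrightarrow> state_desc n w \<le> state_desc m w"
  by (induction rule: dec_induct) (auto intro: le_infI1)

text \<open>Stands for the condition that only the first \<open>n\<close> predicates occur, which is
  not invariant under Boolean equivalence; this formulation is.\<close>

definition decided :: "nat \<Rightarrow> bterm \<Rightarrow> bool" where
  "decided n t \<longleftrightarrow> (\<forall>w. state_desc n w \<le> t \<or> state_desc n w \<le> - t)"

lemma decided_mono: "decided m t \<Longrightarrow> m \<le> n \<Longrightarrow> decided n t"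
  unfolding decided_def using state_desc_antimono order_trans by metis

lemma decided_top: "decided n top" by (simp add: decided_def)

lemma decided_uminus: "decided n t \<Longrightarrow> decided n (- t)" by (auto simp: decided_def)

lemma decided_inf: "decided n t \<Longrightarrow> decided n u \<Longrightarrow> decided n (inf t u)"
  unfolding decided_def by (metis compl_inf le_infI le_supI1 le_supI2)

lemma decided_sup: "decided n t \<Longrightarrow> decided n u \<Longrightarrow> decided n (sup t u)"
  using decided_uminus[OF decided_inf[of n "- t" "- u"]] decided_uminus by simp

lemma decided_bot: "decided n bot"
  using decided_uminus[OF decided_top] by simp

lemma decided_TVar: "i < n \<Longrightarrow> decided n (TVar i)"
  by (rule decided_mono[of "Suc i"]) (auto simp: decided_def)

lemma decided_TConj: "(\<And>t. t \<in> set ts \<Longrightarrow> decided n t) \<Longrightarrow> decided n (TConj ts)"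
  by (induction ts) (auto simp: TConj_def lattice_ops intro: decided_inf decided_top)

lemma decided_TDisj: "(\<And>t. t \<in> set ts \<Longrightarrow> decided n t) \<Longrightarrow> decided n (TDisj ts)"
  by (induction ts) (auto simp: TDisj_def lattice_ops intro: decided_sup decided_bot)

lemma decided_state_desc: "decided n (state_desc m w)" if "m \<le> n"
  using that
  by (induction m) (auto intro!: decided_top decided_inf decided_uminus decided_TVar)

lemma ex_decided: "\<exists>n. decided n t"
proof (induction t rule: bterm_induct)
  case (TVar x)
  show ?case using decided_TVar by blast
next
  case (TNeg t)
  then show ?case unfolding lattice_ops using decided_uminus by blast
next
  case (TAnd t u)
  then obtain m n where "decided m t" "decided n u" by blast
  then have "decided (max m n) t" "decided (max m n) u"
    by (meson decided_mono max.cobounded1 max.cobounded2)+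
  then show ?case unfolding lattice_ops using decided_inf by blast
qed

text \<open>The two extensions of a description by predicate \<open>n\<close> join to that
  description, so the meet of their two implications is the implication from the shorter one. At
  length 0 the description is \<open>top\<close> and the implication is \<open>t\<close>
  itself.\<close>

lemma state_desc_split:
  assumes "\<And>w. P (sup (- state_desc n w) t)"
    and inf: "\<And>t u. P t \<Longrightarrow> P u \<Longrightarrow> P (inf t u)"
  shows "P t"
  using assms(1)
proof (induction n)
  case 0
  then show ?case by simp
next
  case (Suc n)
  have "P (sup (- state_desc n w) t)" for w
  proof -
    have 1: "state_desc n (set_bit n w) = state_desc n w" "state_desc n (unset_bit n w) = state_desc n w"
      by (auto intro!: state_desc_cong simp: bit_simps)
    have "inf (sup (- state_desc (Suc n) (set_bit n w)) t) (sup (- state_desc (Suc n) (unset_bit n w)) t)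
      = sup (inf (sup (- state_desc n w) (- TVar n)) (sup (- state_desc n w) (TVar n))) t"
      by (simp add: 1 bit_simps sup_inf_distrib2)
    also have "\<dots> = sup (- state_desc n w) t"
      by (simp flip: sup_inf_distrib1)
    finally show ?thesis using inf[OF Suc.prems Suc.prems] by metis
  qed
  then show ?case by (rule Suc.IH)
qed

lemma denot_state_desc:
  assumes "v \<in> W" "\<And>i. V i = {w \<in> W. bit w i}"
  shows "v \<in> denot W V (state_desc n w) \<longleftrightarrow> (\<forall>i<n. bit v i = bit w i)"
proof (induction n)
  case (Suc n)
  have "denot W V (TVar n) = {w \<in> W. bit w n}"
    using assms(2) by (subst denot_simps) auto
  then show ?case
    using Suc assms(1) by (auto simp: denot_inf denot_uminus less_Suc_eq)
qed (simp add: denot_top assms(1))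

section \<open>Maximal theories\<close>

lemma taut3:
  "tautology a \<Longrightarrow> \<Gamma> \<turnstile> psubst ((!) [p, q, r]) a"
  by (rule derivable.taut)

abbreviation PImp :: "pform \<Rightarrow> pform \<Rightarrow> pform" where
  "PImp a b \<equiv> PNeg (PAnd a (PNeg b))"

abbreviation (input) "P0 \<equiv> PVar 0"
abbreviation (input) "P1 \<equiv> PVar (Suc 0)"
abbreviation (input) "P2 \<equiv> PVar (Suc (Suc 0))"

lemma derivable_refl: "\<Gamma> \<turnstile> Imp p p"
  using taut3[of "PImp P0 P0" \<Gamma> p] by (simp add: tautology_def Imp_def)

lemma derivable_K: "\<Gamma> \<turnstile> Imp q (Imp p q)"
  using taut3[of "PImp P1 (PImp P0 P1)" \<Gamma> p q] by (simp add: tautology_def Imp_def)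

lemma derivable_S: "\<Gamma> \<turnstile> Imp (Imp p q) (Imp (Imp p (Imp q r)) (Imp p r))"
  using taut3[of "PImp (PImp P0 P1) (PImp (PImp P0 (PImp P1 P2)) (PImp P0 P2))" \<Gamma> p q r]
  by (simp add: tautology_def Imp_def)

lemma derivable_cases: "\<Gamma> \<turnstile> Imp (Imp p q) (Imp (Imp (Neg p) q) q)"
  using taut3[of "PImp (PImp P0 P1) (PImp (PImp (PNeg P0) P1) P1)" \<Gamma> p q]
  by (auto simp add: tautology_def Imp_def)

lemma derivable_explosion: "\<Gamma> \<turnstile> Imp p (Imp (Neg p) q)"
  using taut3[of "PImp P0 (PImp (PNeg P0) P1)" \<Gamma> p q]
  by (simp add: tautology_def Imp_def)

lemma derivable_andI: "\<Gamma> \<turnstile> Imp p (Imp q (And p q))"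
  using taut3[of "PImp P0 (PImp P1 (PAnd P0 P1))" \<Gamma> p q]
  by (simp add: tautology_def Imp_def)

lemma derivable_and1: "\<Gamma> \<turnstile> Imp (And p q) p"
  using taut3[of "PImp (PAnd P0 P1) P0" \<Gamma> p q] by (simp add: tautology_def Imp_def)

lemma derivable_and2: "\<Gamma> \<turnstile> Imp (And p q) q"
  using taut3[of "PImp (PAnd P0 P1) P1" \<Gamma> p q] by (simp add: tautology_def Imp_def)

lemma derivable_mono: "\<Gamma> \<turnstile> p \<Longrightarrow> \<Gamma> \<subseteq> \<Delta> \<Longrightarrow> \<Delta> \<turnstile> p"
  by (induction rule: derivable.induct) (auto intro: derivable.intros)

lemma derivable_finite: "\<Gamma> \<turnstile> p \<Longrightarrow> \<exists>F. finite F \<and> F \<subseteq> \<Gamma> \<and> F \<turnstile> p"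
proof (induction rule: derivable.induct)
  case (premise p)
  then show ?case by (intro exI[of _ "{p}"]) (auto intro: derivable.premise)
next
  case (mp p q)
  then obtain F G where "finite F" "F \<subseteq> \<Gamma>" "F \<turnstile> p" "finite G" "G \<subseteq> \<Gamma>" "G \<turnstile> Imp p q" by blast
  moreover from this have "F \<union> G \<turnstile> q"
    by (meson Un_upper1 Un_upper2 derivable.mp derivable_mono)
  ultimately show ?case by (intro exI[of _ "F \<union> G"]) simp
qed (auto intro!: exI[of _ "{}"] intro: derivable.intros)

lemma deduction: "insert p \<Gamma> \<turnstile> q \<Longrightarrow> \<Gamma> \<turnstile> Imp p q"
proof (induction rule: derivable.induct)
  case (premise q)
  then show ?case by (metis insertE derivable.mp derivable.premise derivable_K derivable_refl)
next
  case (mp q r)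
  then show ?case using derivable.mp derivable_S by meson
qed (meson derivable.intros derivable_K)+

text \<open>Left to right, \<open>Neg_iff\<close> is consistency; right to left,
  completeness.\<close>

locale maximal_theory =
  fixes \<Delta> :: "sentence set"
  assumes closed: "\<Delta> \<turnstile> p \<Longrightarrow> p \<in> \<Delta>"
    and Neg_iff: "Neg p \<in> \<Delta> \<longleftrightarrow> p \<notin> \<Delta>"

text \<open>Zorn's lemma on the extensions of \<Gamma> that do not derive \<phi>; unions of chains
  stay inside because derivations use finitely many premises. A maximal one derives
  \<open>Imp p \<phi>\<close> for each \<open>p\<close> outside it, by the deduction theorem;
  closure and completeness come from this.\<close>

lemma lindenbaum:
  assumes "\<not> \<Gamma> \<turnstile> \<phi>"
  shows "\<exists>\<Delta>. \<Gamma> \<subseteq> \<Delta> \<and> \<phi> \<notin> \<Delta> \<and> maximal_theory \<Delta>"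
proof -
  let ?A = "{\<Delta>. \<Gamma> \<subseteq> \<Delta> \<and> \<not> \<Delta> \<turnstile> \<phi>}"
  have "\<exists>\<Delta>\<in>?A. \<forall>X\<in>?A. \<Delta> \<subseteq> X \<longrightarrow> X = \<Delta>"
  proof (rule subset_Zorn_nonempty)
    show "?A \<noteq> {}" using assms by blast
    fix C assume C: "C \<noteq> {}" "subset.chain ?A C"
    have "\<not> \<Union>C \<turnstile> \<phi>"
    proof
      assume "\<Union>C \<turnstile> \<phi>"
      then obtain F where F: "finite F" "F \<subseteq> \<Union>C" "F \<turnstile> \<phi>" using derivable_finite by blast
      obtain X where X: "X \<in> C" "F \<subseteq> X"
        using finite_subset_Union_chain[OF F(1,2) C] by blast
      have "X \<in> ?A" using C(2) X(1) by (auto simp: subset.chain_def)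
      then show False using F(3) X(2) derivable_mono by blast
    qed
    moreover have "\<Gamma> \<subseteq> \<Union>C" using C by (fastforce simp: subset.chain_def)
    ultimately show "\<Union>C \<in> ?A" by blast
  qed
  then obtain \<Delta> where "\<Delta> \<in> ?A" and max: "\<forall>X\<in>?A. \<Delta> \<subseteq> X \<longrightarrow> X = \<Delta>" by (rule bexE)
  then have \<Delta>: "\<Gamma> \<subseteq> \<Delta>" "\<not> \<Delta> \<turnstile> \<phi>" by simp_all
  have outside: "\<Delta> \<turnstile> Imp p \<phi>" if "p \<notin> \<Delta>" for p
  proof (rule deduction, rule ccontr)
    assume "\<not> insert p \<Delta> \<turnstile> \<phi>"
    then have "insert p \<Delta> \<in> ?A" using \<Delta>(1) by auto
    then have "insert p \<Delta> = \<Delta>" using max by blast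
    then show False using that by blast
  qed
  show ?thesis
  proof (intro exI[of _ \<Delta>] conjI maximal_theory.intro)
    show "\<Gamma> \<subseteq> \<Delta>" by (rule \<Delta>(1))
    show "\<phi> \<notin> \<Delta>" using \<Delta>(2) derivable.premise by blast
    show "p \<in> \<Delta>" if "\<Delta> \<turnstile> p" for p
      using outside \<Delta>(2) derivable.mp that by blast
    show "Neg p \<in> \<Delta> \<longleftrightarrow> p \<notin> \<Delta>" for p
      using outside \<Delta>(2) derivable.mp derivable.premise derivable_cases derivable_explosion
      by meson
  qed
qed

context maximal_theory
begin

lemma Imp_D: "Imp p q \<in> \<Delta> \<Longrightarrow> p \<in> \<Delta> \<Longrightarrow> q \<in> \<Delta>"
  using closed derivable.mp derivable.premise by blast

lemma And_iff: "And p q \<in> \<Delta> \<longleftrightarrow> p \<in> \<Delta> \<and> q \<in> \<Delta>"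
  using Imp_D closed derivable_andI derivable_and1 derivable_and2 by meson

lemma Or_iff: "Or p q \<in> \<Delta> \<longleftrightarrow> p \<in> \<Delta> \<or> q \<in> \<Delta>"
  by (simp add: Or_def Neg_iff And_iff)

lemma Conj_iff: "Conj ps \<in> \<Delta> \<longleftrightarrow> set ps \<subseteq> \<Delta>"
  by (induction ps) (auto simp: Conj_def And_iff Neg_iff Top_def Bot_def)

lemma Half_iff: "Half t \<in> \<Delta> \<longleftrightarrow> Most t \<notin> \<Delta> \<and> Most (- t) \<notin> \<Delta>"
  by (simp add: Half_def And_iff Neg_iff lattice_ops)

text \<open>The conjunct \<open>Neg (Most t)\<close> of \<open>Half t\<close> is absorbed by the
  disjunct \<open>Most t\<close>.\<close>

lemma AtLeastHalf_iff: "AtLeastHalf t \<in> \<Delta> \<longleftrightarrow> Most t \<in> \<Delta> \<or> Most (- t) \<notin> \<Delta>"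
  by (auto simp: AtLeastHalf_def Or_iff Half_iff)

lemma Every_top: "Every top \<in> \<Delta>" and not_Every_bot: "Every bot \<notin> \<Delta>"
  using closed[OF derivable.nonempty] by (simp_all add: And_iff Exists_def Neg_iff lattice_ops)

lemma Every_mp: "Every (sup (- t) u) \<in> \<Delta> \<Longrightarrow> Every t \<in> \<Delta> \<Longrightarrow> Every u \<in> \<Delta>"
  using Imp_D closed[OF derivable.all_imp] by (metis TImp_eq)

lemma Every_mono: "t \<le> u \<Longrightarrow> Every t \<in> \<Delta> \<Longrightarrow> Every u \<in> \<Delta>"
  using Every_mp[of t u] Every_top by (metis double_compl sup_shunt)

text \<open>\<open>sup (- u) (inf t u)\<close> lies above \<open>t\<close>, so the implication
  needed by \<open>Every_mp\<close> follows from \<open>Every t\<close>.\<close>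

lemma Every_inf: "Every t \<in> \<Delta> \<Longrightarrow> Every u \<in> \<Delta> \<Longrightarrow> Every (inf t u) \<in> \<Delta>"
  by (rule Every_mp[of u]) (auto simp: sup_inf_distrib1 intro: Every_mono[of t])

end

section \<open>The canonical model\<close>

lemma filter_in_subseqs: "filter P xs \<in> set (subseqs xs)"
  by (induction xs) (auto simp: Let_def)

lemma length_filter_nth: "length (filter P us) = length (filter (\<lambda>i. P (us ! i)) [0..<length us])"
  using arg_cong[OF map_nth[of us], of "\<lambda>xs. length (filter P xs)"]
  by (simp add: filter_map comp_def)

locale canonical = maximal_theory +
  fixes n :: nat
begin

text \<open>The bound keeps one number per state description over \<open>n\<close> predicates. That
  \<open>Every\<close> of the negation is absent from \<open>\<Delta>\<close> means that
  \<open>\<Delta>\<close> asserts existence.\<close>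

definition worlds_n :: "nat set" ("W") where
  "W = {w. w < 2 ^ n \<and> Every (- state_desc n w) \<notin> \<Delta>}"

definition val :: "nat \<Rightarrow> nat set" where
  "val i = {w \<in> W. bit w i}"

abbreviation D :: "bterm \<Rightarrow> nat set" where
  "D \<equiv> denot W val"

lemma finite_W: "finite W"
  by (rule finite_subset[of _ "{..<2 ^ n}"]) (auto simp: worlds_n_def)

lemma D_subset: "D t \<subseteq> W"
  by (rule denot_subset)

text \<open>Each \<open>w\<close> lies in its own state description, so monotonicity gives one
  direction of both equivalences; decidedness turns these into the converses.\<close>

lemma D_iff:
  assumes "decided n t" "w \<in> W"
  shows "w \<in> D t \<longleftrightarrow> state_desc n w \<le> t" "w \<notin> D t \<longleftrightarrow> state_desc n w \<le> - t"
proof -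
  have "w \<in> D (state_desc n w)"
    using denot_state_desc[OF assms(2), of val] by (simp add: val_def)
  then have "state_desc n w \<le> t \<Longrightarrow> w \<in> D t" "state_desc n w \<le> - t \<Longrightarrow> w \<notin> D t"
    using denot_mono[of "state_desc n w" t W val] denot_mono[of "state_desc n w" "- t" W val]
    by (auto simp: denot_uminus)
  then show "w \<in> D t \<longleftrightarrow> state_desc n w \<le> t" "w \<notin> D t \<longleftrightarrow> state_desc n w \<le> - t"
    using assms(1) by (auto simp: decided_def)
qed

text \<open>A decided term failing at a world entails the negation of its description, which
  contradicts the choice of worlds. Conversely, each description either belongs to a world, where it
  entails \<open>t\<close>, or is negated universally in \<open>\<Delta>\<close>;
  \<open>state_desc_split\<close> combines these cases.\<close>

lemma Every_iff:
  assumes "decided n t"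
  shows "Every t \<in> \<Delta> \<longleftrightarrow> D t = W"
proof
  assume t: "Every t \<in> \<Delta>"
  have "w \<in> D t" if w: "w \<in> W" for w
  proof (rule ccontr)
    assume "w \<notin> D t"
    then have "t \<le> - state_desc n w"
      using D_iff[OF assms w] by (simp add: compl_le_swap1)
    then show False using w t Every_mono by (auto simp: worlds_n_def)
  qed
  then show "D t = W" using D_subset by blast
next
  assume D: "D t = W"
  show "Every t \<in> \<Delta>"
  proof (rule state_desc_split[where P = "\<lambda>t. Every t \<in> \<Delta>"])
    fix w
    \<comment> \<open>\<open>take_bit n w\<close> is the representative below \<open>2 ^ n\<close>
      with the same description as \<open>w\<close>.\<close>
    have eq: "state_desc n (take_bit n w) = state_desc n w"
      by (rule state_desc_cong) (simp add: bit_simps)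
    show "Every (sup (- state_desc n w) t) \<in> \<Delta>"
    proof (cases "take_bit n w \<in> W")
      case True
      then have "state_desc n w \<le> t" using D_iff(1)[OF assms True] D eq by simp
      then have "sup (- state_desc n w) t = top" by (simp add: sup_shunt)
      then show ?thesis by (simp add: Every_top)
    next
      case False
      then have "Every (- state_desc n w) \<in> \<Delta>"
        by (simp add: worlds_n_def eq)
      then show ?thesis by (rule Every_mono[rotated]) simp
    qed
  qed (rule Every_inf)
qed

lemma W_nonempty: "W \<noteq> {}"
  using Every_iff[OF decided_bot] not_Every_bot by (auto simp: denot_bot)

text \<open>A world is the only one satisfying its state description, so joins of descriptions name
  all sets of worlds.\<close>

lemma subset_definable:
  assumes "A \<subseteq> W"
  shows "\<exists>t. decided n t \<and> D t = A"
  using finite_subset[OF assms finite_W] assms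
proof (induction A rule: finite_induct)
  case empty
  show ?case by (intro exI[of _ bot]) (simp add: decided_bot denot_bot)
next
  case (insert w A)
  then obtain t where t: "decided n t" "D t = A" by auto
  have uniq: "v = w" if "v \<in> W" "\<forall>i<n. bit v i = bit w i" for v
  proof -
    have "take_bit n v = take_bit n w"
      using that by (auto intro!: bit_eqI simp: bit_simps)
    then show ?thesis using that insert.prems by (simp add: worlds_n_def take_bit_nat_eq_self)
  qed
  have "v \<in> D (state_desc n w) \<longleftrightarrow> v = w" if "v \<in> W" for v
    using denot_state_desc[OF that val_def, of n w] uniq[OF that] by blast
  then have "D (state_desc n w) = {w}"
    using D_subset[of "state_desc n w"] insert.prems by blast
  then show ?case
    using t decided_sup[OF decided_state_desc[of n n w] t(1)]
    by (intro exI[of _ "sup (state_desc n w) t"]) (simp add: denot_sup)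
qed

text \<open>The coherence axiom for \<open>us\<close>, moved through \<open>Every_iff\<close>: its
  antecedent says that each world falsifies at least half of the terms, its consequent that each
  satisfies exactly half.\<close>

lemma coherence_denot:
  assumes dec: "\<And>u. u \<in> set us \<Longrightarrow> decided n u"
    and alh: "\<And>u. u \<in> set us \<Longrightarrow> Most u \<in> \<Delta> \<or> Most (- u) \<notin> \<Delta>"
    and le: "\<And>w. w \<in> W \<Longrightarrow> 2 * length (filter (\<lambda>u. w \<in> D u) us) \<le> length us"
  shows "u \<in> set us \<Longrightarrow> Most u \<notin> \<Delta>"
    and "w \<in> W \<Longrightarrow> 2 * length (filter (\<lambda>u. w \<in> D u) us) = length us"
proof -
  define k where "k = length us"
  let ?t1 = "TDisj [TConj [TNeg (us ! i). i \<leftarrow> S]. S \<leftarrow> subseqs [0..<k], 2 * length S \<ge> k]"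
  let ?t2 = "TDisj [TAnd (TConj [us ! i. i \<leftarrow> S]) (TConj [TNeg (us ! i). i \<leftarrow> [0..<k], i \<notin> set S]).
    S \<leftarrow> subseqs [0..<k], 2 * length S = k]"
  have range: "i < k" if "S \<in> set (subseqs [0..<k])" "i \<in> set S" for S i
    using that subseqs_powset[of "[0..<k]"] by (metis PowD atLeastLessThan_iff image_eqI set_upt subsetD)
  have dec': "decided n (us ! i)" if "i < k" for i
    using that dec by (simp add: k_def)
  have dec1: "decided n ?t1"
    using range dec'
    by (intro decided_TDisj) (auto simp: lattice_ops split: if_splits intro!: decided_TConj decided_uminus)
  have dec2: "decided n ?t2"
    using range dec'
    by (intro decided_TDisj)
      (auto simp: lattice_ops split: if_splits intro!: decided_inf decided_TConj decided_uminus)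
  have "w \<in> D ?t1" if w: "w \<in> W" for w
  proof -
    \<comment> \<open>The indices of the terms false at \<open>w\<close> give a disjunct that holds
      there; as a filtered list they occur among the \<open>subseqs\<close>.\<close>
    let ?S = "filter (\<lambda>i. w \<notin> D (us ! i)) [0..<k]"
    have "length (filter (\<lambda>i. w \<in> D (us ! i)) [0..<k]) + length ?S = k"
      using sum_length_filter_compl[of "\<lambda>i. w \<in> D (us ! i)" "[0..<k]"] by simp
    then have "k \<le> 2 * length ?S"
      using le[OF w] by (simp add: length_filter_nth[of _ us] k_def)
    then show ?thesis
      using w filter_in_subseqs[of "\<lambda>i. w \<notin> D (us ! i)" "[0..<k]"]
      by (auto simp: denot_TDisj denot_TConj denot_uminus lattice_ops intro!: bexI[of _ ?S])
  qed
  then have "Every ?t1 \<in> \<Delta>"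
    using Every_iff[OF dec1] D_subset by blast
  moreover have "Conj (map AtLeastHalf us) \<in> \<Delta>"
    using alh by (auto simp: Conj_iff AtLeastHalf_iff)
  ultimately have "And (Conj (map Half us)) (Every ?t2) \<in> \<Delta>"
    using closed[OF derivable.coherence[of _ us]]
    unfolding coherence_def Let_def k_def[symmetric] by (blast intro: Imp_D And_iff[THEN iffD2])
  then have half: "\<And>u. u \<in> set us \<Longrightarrow> Half u \<in> \<Delta>" and "D ?t2 = W"
    using Every_iff[OF dec2] by (auto simp: And_iff Conj_iff)
  show "Most u \<notin> \<Delta>" if "u \<in> set us"
    using half[OF that] by (simp add: Half_iff)
  assume w: "w \<in> W"
  then have "w \<in> D ?t2" using \<open>D ?t2 = W\<close> by simp
  then obtain S where S: "S \<in> set (subseqs [0..<k])" "2 * length S = k"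
    and mem: "\<And>i. i \<in> set S \<Longrightarrow> w \<in> D (us ! i)" "\<And>i. i < k \<Longrightarrow> i \<notin> set S \<Longrightarrow> w \<notin> D (us ! i)"
    by (fastforce simp: denot_TDisj denot_TConj denot_inf denot_uminus lattice_ops split: if_splits)
  \<comment> \<open>The disjunct holding at \<open>w\<close> fixes the truth value of every term, so
    \<open>S\<close> consists of exactly the indices true at \<open>w\<close>.\<close>
  have "set (filter (\<lambda>i. w \<in> D (us ! i)) [0..<k]) = set S"
    using mem range[OF S(1)] by auto
  moreover have "distinct S"
    using S(1) by (rule subseqs_distinctD) simp
  ultimately have "length (filter (\<lambda>i. w \<in> D (us ! i)) [0..<k]) = length S"
    by (metis distinct_card distinct_filter distinct_upt)
  then show "2 * length (filter (\<lambda>u. w \<in> D u) us) = length us"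
    using S(2) by (simp add: length_filter_nth[of _ us] k_def)
qed

text \<open>Makes membership in \<open>majors\<close> independent of the naming term. If
  \<open>Most u\<close> failed, \<open>- u\<close> would be at least half; as \<open>t\<close> and
  \<open>u\<close> agree, each world lies in exactly one of \<open>t\<close> and \<open>- u\<close>,
  so coherence would rule out \<open>Most t\<close>.\<close>

lemma Most_cong:
  assumes "decided n t" "decided n u" "D t = D u" "Most t \<in> \<Delta>"
  shows "Most u \<in> \<Delta>"
proof (rule ccontr)
  assume "Most u \<notin> \<Delta>"
  then have "Most t \<notin> \<Delta>"
    using assms by (intro coherence_denot(1)[of "[t, - u]"])
      (auto simp: denot_uminus decided_uminus)
  then show False using assms by simp
qed

definition majors :: "nat set set" where
  "majors = {D t |t. decided n t \<and> Most t \<in> \<Delta>}"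

lemma Most_iff: "decided n t \<Longrightarrow> Most t \<in> \<Delta> \<longleftrightarrow> D t \<in> majors"
  using Most_cong by (auto simp: majors_def)

lemma canonical_frame: "frame W majors"
  using finite_W W_nonempty D_subset by (auto simp: frame_def majors_def)

text \<open>Naming each set by a term turns a sequence of sets into a sequence of terms, to which
  \<open>coherence_denot\<close> applies.\<close>

lemma canonical_coherent: "coherent_frame W majors"
  unfolding coherent_frame_def
proof (intro allI impI)
  fix As
  assume As: "\<forall>A\<in>set As. A \<subseteq> W \<and> (A \<in> majors \<or> W - A \<notin> majors)"
    and le: "\<forall>w\<in>W. 2 * length (filter (\<lambda>A. w \<in> A) As) \<le> length As"
  obtain t where t: "\<And>A. A \<subseteq> W \<Longrightarrow> decided n (t A)" "\<And>A. A \<subseteq> W \<Longrightarrow> D (t A) = A"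
    using subset_definable by metis
  have count: "length (filter (\<lambda>u. w \<in> D u) (map t As)) = length (filter (\<lambda>A. w \<in> A) As)" for w
    using As t(2) by (auto simp: filter_map intro!: arg_cong[of _ _ length] filter_cong)
  have M: "Most (t A) \<in> \<Delta> \<longleftrightarrow> A \<in> majors" "Most (- t A) \<in> \<Delta> \<longleftrightarrow> W - A \<in> majors" if "A \<subseteq> W" for A
    using t[OF that] by (simp_all add: Most_iff decided_uminus denot_uminus)
  have "(\<forall>u\<in>set (map t As). Most u \<notin> \<Delta>) \<and>
      (\<forall>w\<in>W. 2 * length (filter (\<lambda>u. w \<in> D u) (map t As)) = length (map t As))"
    using As le count t(1) M
    by (intro conjI ballI coherence_denot[of "map t As"]) auto
  then show "(\<forall>A\<in>set As. A \<notin> majors) \<and> (\<forall>w\<in>W. 2 * length (filter (\<lambda>A. w \<in> A) As) = length As)"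
    using As M count by auto
qed

definition canonical_model :: "nat model" where
  "canonical_model = \<lparr>worlds = W, majorities = majors, interp = val\<rparr>"

lemma canonical_model_measurable: "measurable_model canonical_model"
  using canonical_frame coherent_frame_measurable[OF canonical_frame canonical_coherent]
  by (auto simp: measurable_model_def is_model_def canonical_model_def val_def)

end

section \<open>Truth lemma and completeness\<close>

primrec terms_of :: "sentence \<Rightarrow> bterm set" where
  "terms_of (Every t) = {t}"
| "terms_of (Most t) = {t}"
| "terms_of (Neg p) = terms_of p"
| "terms_of (And p q) = terms_of p \<union> terms_of q"

lemma finite_terms_of: "finite (terms_of p)"
  by (induction p) auto

lemma (in canonical) truth:
  "\<forall>t\<in>terms_of p. decided n t \<Longrightarrow> canonical_model \<Turnstile> p \<longleftrightarrow> p \<in> \<Delta>"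
  by (induction p) (auto simp: canonical_model_def Every_iff Most_iff Neg_iff And_iff)

lemma finite_decided:
  assumes "finite T"
  shows "\<exists>n. \<forall>t\<in>T. decided n t"
  using assms
proof (induction T rule: finite_induct)
  case (insert t T)
  then obtain m n where mn: "decided m t" "\<forall>u\<in>T. decided n u" using ex_decided by blast
  have "decided (max m n) t" using mn(1) by (rule decided_mono) simp
  moreover have "decided (max m n) u" if "u \<in> T" for u
    using mn(2)[rule_format, OF that] by (rule decided_mono) simp
  ultimately show ?case by blast
qed simp

theorem theorem4p4:
  fixes \<Gamma> :: "sentence set" and \<phi> :: sentence
  assumes "finite \<Gamma>"
    and "\<And>\<MM> :: nat model. measurable_model \<MM> \<Longrightarrow> (\<forall>\<psi>\<in>\<Gamma>. \<MM> \<Turnstile> \<psi>) \<Longrightarrow> \<MM> \<Turnstile> \<phi>"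
  shows "\<Gamma> \<turnstile> \<phi>"
proof (rule ccontr)
  assume "\<not> \<Gamma> \<turnstile> \<phi>"
  then obtain \<Delta> where \<Delta>: "\<Gamma> \<subseteq> \<Delta>" "\<phi> \<notin> \<Delta>" "maximal_theory \<Delta>"
    using lindenbaum by blast
  \<comment> \<open>Finiteness of \<Gamma> gives one bound for all terms involved, so that
    \<open>truth\<close> applies to every sentence at issue.\<close>
  obtain n where n: "\<forall>t\<in>(\<Union>p\<in>insert \<phi> \<Gamma>. terms_of p). decided n t"
    using finite_decided[of "\<Union>p\<in>insert \<phi> \<Gamma>. terms_of p"] assms(1) finite_terms_of by auto
  interpret canonical \<Delta> n using \<Delta>(3) by (rule canonical.intro)
  have truth': "canonical_model \<Turnstile> p \<longleftrightarrow> p \<in> \<Delta>" if "p \<in> insert \<phi> \<Gamma>" for p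
    using that n by (intro truth) blast
  then have "\<forall>\<psi>\<in>\<Gamma>. canonical_model \<Turnstile> \<psi>" using \<Delta>(1) by blast
  \<comment> \<open>The canonical worlds are natural numbers, the world type of the models in the
    hypothesis.\<close>
  then have "canonical_model \<Turnstile> \<phi>" by (rule assms(2)[OF canonical_model_measurable])
  then show False using truth' \<Delta>(2) by blast
qed

end
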